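(* Let $D$ be an ordinary graph of type $\langle n,k,a,b,c\rangle$, and let $d=\max\{a,b,c\}$. If $k-d>\log n$, then $$\zeta(D)\le\dim(D)\le\left\lceil \frac{n\log n}{k-d}\right\rceil .$$
   Context: Digraphs are finite, without loops or multiple arcs (two opposite arcs between a pair of vertices are allowed); $\log$ is the natural logarithm. A digraph is $k$-regular if every vertex has in-degree and out-degree $k$. A digraph $D$ is an ordinary graph of type $\langle n,k,a,b,c\rangle$ if $D$ has $n$ vertices, is $k$-regular, and for any pair of distinct vertices $x,y$ the number of common in-neighbours and the number of common out-neighbours of $x$ and $y$ are both equal to $a$ if there is no arc between $x$ and $y$, $b$ if there is a single arc between $x$ and $y$, and $c$ if there are arcs in both directions. Distance $d(w,u)$ in a digraph is the length of a shortest directed path from $w$ to $u$, taken to be $\infty$ if there is none. A resolving set of $D$ is a set $R\subseteq V(D)$ such that for each pair of distinct vertices $u,v\notin R$ there is $w\in R$ with $d(w,u)\ne d(w,v)$. The metric dimension $\dim(D)$ is the least size of a resolving set. Localization game on $D$: one player controls a set of cops, the other an invisible robber. The robber first chooses an initial vertex. In each subsequent round the cops move (each cop may choose any vertex to occupy), and then the robber moves along an arc to an out-neighbour or stays. After each robber move, if the cops occupy $u_1,\dots,u_j$, they receive the vector of distances $d(u_i,x)$, $1\le i\le j$, where $x$ is the robber's vertex. The robber is located if in some round there is a unique vertex the robber can occupy that corresponds to the distance vector received (the cops may use information from previous rounds). The localization number $\zeta(D)$ is the minimum number of cops for which there is a strategy guaranteed to locate the robber in a finite number of rounds. *)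

theory Defs
  imports "Graph_Theory.Shortest_Path"
begin

section \<open>Ordinary graphs\<close>

definition regular :: "('a, 'b) pre_digraph \<Rightarrow> nat \<Rightarrow> bool" where
  "regular G k \<longleftrightarrow> (\<forall>v \<in> verts G. in_degree G v = k \<and> out_degree G v = k)"

definition common_in_neighbours :: "('a, 'b) pre_digraph \<Rightarrow> 'a \<Rightarrow> 'a \<Rightarrow> 'a set" where
  "common_in_neighbours G x y = {z \<in> verts G. z \<rightarrow>\<^bsub>G\<^esub> x \<and> z \<rightarrow>\<^bsub>G\<^esub> y}"

definition common_out_neighbours :: "('a, 'b) pre_digraph \<Rightarrow> 'a \<Rightarrow> 'a \<Rightarrow> 'a set" where
  "common_out_neighbours G x y = {z \<in> verts G. x \<rightarrow>\<^bsub>G\<^esub> z \<and> y \<rightarrow>\<^bsub>G\<^esub> z}"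

definition ordinary_graph ::
  "('a, 'b) pre_digraph \<Rightarrow> nat \<Rightarrow> nat \<Rightarrow> nat \<Rightarrow> nat \<Rightarrow> nat \<Rightarrow> bool" where
  "ordinary_graph G n k a b c \<longleftrightarrow>
     digraph G \<and> card (verts G) = n \<and> regular G k \<and>
     (\<forall>x \<in> verts G. \<forall>y \<in> verts G. x \<noteq> y \<longrightarrow>
        (let m = (if x \<rightarrow>\<^bsub>G\<^esub> y \<and> y \<rightarrow>\<^bsub>G\<^esub> x then c
                  else if x \<rightarrow>\<^bsub>G\<^esub> y \<or> y \<rightarrow>\<^bsub>G\<^esub> x then b
                  else a)
         in card (common_in_neighbours G x y) = m \<and>
            card (common_out_neighbours G x y) = m))"

section \<open>Distance and metric dimension\<close>

text \<open>Unit weights turn the library's weighted distance into the hop distance. That distance is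
  an infimum over walks (\<open>\<infinity>\<close> if there are none); the lemma below confirms that restricting to
  paths gives the same value.\<close>

definition distance :: "('a, 'b) pre_digraph \<Rightarrow> 'a \<Rightarrow> 'a \<Rightarrow> ereal" where
  "distance G u v = wf_digraph.\<mu> G (\<lambda>_. 1) u v"

lemma (in wf_digraph) distance_eq_shortest_path_length:
  "distance G u v = (INF p \<in> {p. apath u p v}. ereal (real (length p)))"
proof -
  have cost: "awalk_cost (\<lambda>_. 1) p = real (length p)" for p
    by (induction p) auto
  have shorter: "length (awalk_to_apath p) \<le> length p" if "awalk u p v" for p
    using that
  proof (induction rule: awalk_to_apath_induct)
    case (path p)
    then have "awalk_to_apath p = p" by (auto simp: awalk_to_apath.simps)
    then show ?case by simp
  next
    case (decomp p q r s)
    then have "awalk_to_apath p = awalk_to_apath (q @ s)"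
      by (intro step_awalk_to_apath)
    moreover have "p = q @ r @ s"
      using decomp by (auto elim: awalk_cyc_decompE)
    ultimately show ?case using decomp by simp
  qed
  show ?thesis
    unfolding distance_def \<mu>_def cost
  proof (rule INF_eq)
    fix p assume "p \<in> {p. awalk u p v}"
    then have "apath u (awalk_to_apath p) v" "length (awalk_to_apath p) \<le> length p"
      by (auto intro: apath_awalk_to_apath shorter)
    then show "\<exists>q \<in> {p. apath u p v}. ereal (real (length q)) \<le> ereal (real (length p))"
      by auto
  next
    fix p assume "p \<in> {p. apath u p v}"
    then show "\<exists>q \<in> {p. awalk u p v}. ereal (real (length q)) \<le> ereal (real (length p))"
      by (auto simp: apath_def)
  qed
qed

definition resolving_set :: "('a, 'b) pre_digraph \<Rightarrow> 'a set \<Rightarrow> bool" where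
  "resolving_set G R \<longleftrightarrow> R \<subseteq> verts G \<and>
     (\<forall>u \<in> verts G - R. \<forall>v \<in> verts G - R. u \<noteq> v \<longrightarrow>
        (\<exists>w \<in> R. distance G w u \<noteq> distance G w v))"

definition metric_dimension :: "('a, 'b) pre_digraph \<Rightarrow> nat" where
  "metric_dimension G = (LEAST m. \<exists>R. resolving_set G R \<and> card R = m)"

section \<open>The localization game\<close>

text \<open>\<open>x 0\<close> is the initial vertex of the robber, and \<open>x t\<close> is the vertex of the robber at the end of
  round \<open>t\<close>, for \<open>t \<ge> 1\<close>.\<close>

definition robber_play :: "('a, 'b) pre_digraph \<Rightarrow> (nat \<Rightarrow> 'a) \<Rightarrow> bool" where
  "robber_play G x \<longleftrightarrow> x 0 \<in> verts G \<and> (\<forall>t. x (Suc t) = x t \<or> x t \<rightarrow>\<^bsub>G\<^esub> x (Suc t))"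

text \<open>The cops see only the distance vectors, so a strategy maps the vectors received in the
  rounds played so far (oldest first) to the positions of the cops in the next round. Cops may
  share a vertex.\<close>

type_synonym 'a cop_strategy = "ereal list list \<Rightarrow> 'a list"

text \<open>\<open>distance_vectors G \<sigma> x t\<close> lists the vectors received in rounds \<open>1, \<dots>, t\<close>.\<close>

primrec distance_vectors ::
  "('a, 'b) pre_digraph \<Rightarrow> 'a cop_strategy \<Rightarrow> (nat \<Rightarrow> 'a) \<Rightarrow> nat \<Rightarrow> ereal list list" where
  "distance_vectors G \<sigma> x 0 = []"
| "distance_vectors G \<sigma> x (Suc t) =
     distance_vectors G \<sigma> x t @
       [map (\<lambda>u. distance G u (x (Suc t))) (\<sigma> (distance_vectors G \<sigma> x t))]"

definition possible_positions ::
  "('a, 'b) pre_digraph \<Rightarrow> 'a cop_strategy \<Rightarrow> (nat \<Rightarrow> 'a) \<Rightarrow> nat \<Rightarrow> 'a set" where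
  "possible_positions G \<sigma> x t =
     {y t | y. robber_play G y \<and> distance_vectors G \<sigma> y t = distance_vectors G \<sigma> x t}"

definition located_in_round ::
  "('a, 'b) pre_digraph \<Rightarrow> 'a cop_strategy \<Rightarrow> (nat \<Rightarrow> 'a) \<Rightarrow> nat \<Rightarrow> bool" where
  "located_in_round G \<sigma> x t \<longleftrightarrow> possible_positions G \<sigma> x t = {x t}"

definition locating_strategy ::
  "('a, 'b) pre_digraph \<Rightarrow> nat \<Rightarrow> 'a cop_strategy \<Rightarrow> bool" where
  "locating_strategy G m \<sigma> \<longleftrightarrow>
     (\<forall>h. length (\<sigma> h) = m \<and> set (\<sigma> h) \<subseteq> verts G) \<and>
     (\<forall>x. robber_play G x \<longrightarrow> (\<exists>t \<ge> 1. located_in_round G \<sigma> x t))"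

definition localization_number :: "('a, 'b) pre_digraph \<Rightarrow> nat" where
  "localization_number G = (LEAST m. \<exists>\<sigma>. locating_strategy G m \<sigma>)"

end

theory Submission
  imports Defs
begin

text \<open>
  Both inequalities come from reading a resolving set as a hitting set. A vertex \<open>w\<close> separates
  \<open>u\<close> from \<open>v\<close> as soon as it is \<open>u\<close> or \<open>v\<close> itself (exactly one of the distances is \<open>0\<close>) or an
  in-neighbour of exactly one of them (exactly one of the distances is at most \<open>1\<close>). Hence a set of
  vertices is resolving once it meets, for every pair \<open>u \<noteq> v\<close>, the symmetric difference of the two
  in-neighbourhoods. In an ordinary graph this symmetric difference has \<open>2 (k - m)\<close> elements with
  \<open>m \<in> {a, b, c}\<close>, hence at least \<open>2 (k - d)\<close> (\<open>card_in_neighbours_sym_diff\<close>). Adding at each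
  step the vertex that meets the most sets still missed leaves, after \<open>r\<close> steps, at most a fraction
  \<open>(1 - 2 (k - d) / n) ^ r\<close> of the fewer than \<open>n\<^sup>2\<close> ordered pairs (\<open>greedy_hitting_set\<close>). With
  \<open>r \<ge> n ln n / (k - d)\<close> this fraction is at most \<open>exp (- 2 ln n) = 1 / n\<^sup>2\<close>, so fewer than one
  pair, that is none, is left.

  For the localization number, cops that never leave a resolving set of least size locate the
  robber in the first round: their distance vector determines the vertex of the robber, also when
  the robber stands on a cop, because the distance \<open>0\<close> then betrays it
  (\<open>resolving_set_determines\<close>).
\<close>

section \<open>Greedy hitting sets\<close>

text \<open>By averaging, some point of \<open>V\<close> lies in at least a fraction \<open>s / card V\<close> of the sets. Taking
  it into the hitting set multiplies the number of sets still missed by at most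
  \<open>1 - s / card V\<close>, which is the induction step.\<close>

lemma greedy_hitting_set:
  fixes S :: "'i \<Rightarrow> 'v set" and s :: real
  assumes "finite V" and "finite I"
    and "\<And>i. i \<in> I \<Longrightarrow> S i \<subseteq> V" and "\<And>i. i \<in> I \<Longrightarrow> s \<le> card (S i)"
    and "card I * (1 - s / card V) ^ r < 1"
  shows "\<exists>R \<subseteq> V. card R \<le> r \<and> (\<forall>i \<in> I. S i \<inter> R \<noteq> {})"
  using assms(2-)
proof (induction r arbitrary: I)
  case 0
  then show ?case by (intro exI[of _ "{}"]) auto
next
  case (Suc r)
  show ?case
  proof (cases "I = {}")
    case True
    then show ?thesis by (intro exI[of _ "{}"]) auto
  next
    case False
    then obtain i where i: "i \<in> I" by auto
    have I: "card I \<ge> 1"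
      using False Suc.prems(1) by (simp add: Suc_le_eq card_gt_0_iff)
    have V: "V \<noteq> {}"
      \<comment> \<open>For empty \<open>V\<close> the division by zero turns the hypothesis into \<open>card I < 1\<close>.\<close>
      using Suc.prems(4) I by auto
    have n: "real (card V) > 0"
      using V assms(1) by (simp add: card_gt_0_iff)
    have "s \<le> card V"
      using Suc.prems(2,3)[OF i] card_mono[OF assms(1), of "S i"] by linarith
    then have q: "0 \<le> 1 - s / card V"
      using n by (simp add: field_simps)
    have "\<exists>v \<in> V. card I * s \<le> card V * card {i \<in> I. v \<in> S i}"
    proof (rule ccontr)
      assume "\<not> ?thesis"
      then have lt: "card V * card {i \<in> I. v \<in> S i} < card I * s" if "v \<in> V" for v
        using that by (auto simp: not_le)
      have "(\<Sum>v\<in>V. real (card V * card {i \<in> I. v \<in> S i})) < (\<Sum>v\<in>V. card I * s)"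
        by (rule sum_strict_mono) (use lt V assms(1) in auto)
      then have "card V * (\<Sum>v\<in>V. real (card {i \<in> I. v \<in> S i})) < card V * (card I * s)"
        by (simp add: sum_distrib_left)
      then have 1: "(\<Sum>v\<in>V. real (card {i \<in> I. v \<in> S i})) < card I * s"
        using n by simp
      have "(\<Sum>v\<in>V. card {i \<in> I. v \<in> S i}) = (\<Sum>v\<in>V. \<Sum>i | i \<in> I \<and> v \<in> S i. 1)"
        by simp
      also have "\<dots> = (\<Sum>i\<in>I. \<Sum>v | v \<in> V \<and> v \<in> S i. 1)"
        by (rule sum.swap_restrict) (use assms(1) Suc.prems(1) in auto)
      also have "\<dots> = (\<Sum>i\<in>I. card (S i))"
      proof (rule sum.cong[OF refl])
        fix i assume "i \<in> I"
        then have "{v. v \<in> V \<and> v \<in> S i} = S i" using Suc.prems(2) by blast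
        then show "(\<Sum>v | v \<in> V \<and> v \<in> S i. 1) = card (S i)" by simp
      qed
      finally have "(\<Sum>v\<in>V. real (card {i \<in> I. v \<in> S i})) = (\<Sum>i\<in>I. real (card (S i)))"
        by (simp flip: of_nat_sum)
      moreover have "(\<Sum>i\<in>I. s) \<le> (\<Sum>i\<in>I. real (card (S i)))"
        by (rule sum_mono) (rule Suc.prems(3))
      ultimately show False using 1 by simp
    qed
    then obtain v where v: "v \<in> V" "card I * s \<le> card V * card {i \<in> I. v \<in> S i}"
      by blast
    let ?J = "{i \<in> I. v \<notin> S i}"
    have "?J = I - {i \<in> I. v \<in> S i}" by auto
    then have "real (card ?J) = card I - real (card {i \<in> I. v \<in> S i})"
      using Suc.prems(1) by (simp add: card_Diff_subset card_mono of_nat_diff)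
    moreover have "card I * (s / card V) \<le> card {i \<in> I. v \<in> S i}"
      using v(2) n by (simp add: field_simps)
    ultimately have J: "real (card ?J) \<le> card I * (1 - s / card V)"
      by (simp add: right_diff_distrib)
    have "card ?J * (1 - s / card V) ^ r \<le> card I * (1 - s / card V) ^ Suc r"
      using mult_right_mono[OF J zero_le_power[OF q, of r]] by (simp add: mult.assoc)
    then have "card ?J * (1 - s / card V) ^ r < 1"
      using Suc.prems(4) by linarith
    then obtain R where R: "R \<subseteq> V" "card R \<le> r" "\<forall>i \<in> ?J. S i \<inter> R \<noteq> {}"
      using Suc.IH[of ?J] Suc.prems(1-3) by auto
    have "card (insert v R) \<le> Suc r"
      using R(2) card_insert_le_m1[of "Suc r" R v] by simp
    then show ?thesis
      using R v(1) by (intro exI[of _ "insert v R"]) auto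
  qed
qed

section \<open>Resolving sets and distances 0 and 1\<close>

text \<open>Only two things need to be known about a distance: whether it is \<open>0\<close>, and whether it is at most
  \<open>1\<close>. As the distance is an infimum of walk lengths, a strict bound on it is witnessed by a walk,
  which these bounds force to have no arc, or at most one.\<close>

lemma (in wf_digraph) distance_less_iff_short_walk:
  "distance G u v < ereal l \<longleftrightarrow> (\<exists>p. awalk u p v \<and> real (length p) < l)"
proof -
  have cost: "awalk_cost (\<lambda>_. 1) p = real (length p)" for p
    by (induction p) auto
  show ?thesis
    unfolding distance_def \<mu>_def cost by (auto simp: INF_less_iff)
qed

lemma (in wf_digraph) distance_less_1_iff:
  assumes "u \<in> verts G"
  shows "distance G u v < ereal 1 \<longleftrightarrow> u = v"
  unfolding distance_less_iff_short_walk
  using assms by (auto simp: awalk_Nil_iff)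

lemma (in wf_digraph) distance_less_2_iff:
  assumes "u \<in> verts G"
  shows "distance G u v < ereal 2 \<longleftrightarrow> u = v \<or> u \<rightarrow>\<^bsub>G\<^esub> v"
proof
  assume "distance G u v < ereal 2"
  then obtain p where p: "awalk u p v" "length p < 2"
    unfolding distance_less_iff_short_walk by auto
  then show "u = v \<or> u \<rightarrow>\<^bsub>G\<^esub> v"
    by (cases p) (auto simp: awalk_Nil_iff awalk_Cons_iff in_arcs_imp_in_arcs_ends)
next
  assume "u = v \<or> u \<rightarrow>\<^bsub>G\<^esub> v"
  then show "distance G u v < ereal 2"
  proof
    assume "u = v"
    then show ?thesis
      unfolding distance_less_iff_short_walk
      using assms by (intro exI[of _ "[]"]) (auto simp: awalk_Nil_iff)
  next
    assume "u \<rightarrow>\<^bsub>G\<^esub> v"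
    then obtain e where "e \<in> arcs G" "tail G e = u" "head G e = v"
      by (auto simp: arcs_ends_def arc_to_ends_def)
    then have "awalk u [e] v" using arc_implies_awalk by blast
    then show ?thesis
      unfolding distance_less_iff_short_walk by (intro exI[of _ "[e]"]) auto
  qed
qed

text \<open>The definition of a resolving set only compares vertices outside of it. Its own vertices are
  recognized by having distance \<open>0\<close> from themselves.\<close>

lemma (in wf_digraph) resolving_set_determines:
  assumes R: "resolving_set G R" and "u \<in> verts G" "v \<in> verts G"
    and eq: "\<And>w. w \<in> R \<Longrightarrow> distance G w u = distance G w v"
  shows "u = v"
proof (cases "u \<in> R \<or> v \<in> R")
  case True
  then obtain w where w: "w \<in> R" "w = u \<or> w = v" by blast
  then have "w \<in> verts G" using R by (auto simp: resolving_set_def)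
  then have "w = u \<longleftrightarrow> w = v"
    using eq[OF w(1)] distance_less_1_iff by metis
  then show ?thesis using w by blast
next
  case False
  then show ?thesis using assms unfolding resolving_set_def by blast
qed

definition in_neighbours :: "('a, 'b) pre_digraph \<Rightarrow> 'a \<Rightarrow> 'a set" where
  "in_neighbours G v = {z \<in> verts G. z \<rightarrow>\<^bsub>G\<^esub> v}"

text \<open>The sets to be hit may be taken smaller than the set of all vertices that separate \<open>u\<close> from
  \<open>v\<close>: a point \<open>w\<close> of the hypothesis is never \<open>u\<close> or \<open>v\<close> when these lie outside \<open>R\<close>, so being
  an in-neighbour is then the same as having distance at most \<open>1\<close>.\<close>

lemma (in wf_digraph) resolving_setI_in_neighbours:
  assumes "R \<subseteq> verts G"
    and hit: "\<And>u v. u \<in> verts G \<Longrightarrow> v \<in> verts G \<Longrightarrow> u \<noteq> v \<Longrightarrow>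
      sym_diff (in_neighbours G u) (in_neighbours G v) \<inter> R \<noteq> {}"
  shows "resolving_set G R"
  unfolding resolving_set_def
proof (intro conjI ballI impI)
  fix u v assume uv: "u \<in> verts G - R" "v \<in> verts G - R" "u \<noteq> v"
  then obtain w where w: "w \<in> R" "w \<in> sym_diff (in_neighbours G u) (in_neighbours G v)"
    using hit[of u v] by blast
  then have "w \<in> verts G" "w \<noteq> u" "w \<noteq> v" using assms(1) uv by auto
  then have "distance G w u < ereal 2 \<longleftrightarrow> \<not> distance G w v < ereal 2"
    using w(2) by (auto simp: distance_less_2_iff in_neighbours_def)
  then show "\<exists>w \<in> R. distance G w u \<noteq> distance G w v" using w(1) by metis
qed (rule assms(1))

section \<open>In-neighbourhoods in ordinary graphs\<close>

text \<open>Degrees count arcs; without multiple arcs this is the same as counting neighbours.\<close>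

lemma (in digraph) card_in_neighbours:
  "card (in_neighbours G v) = in_degree G v"
proof -
  have "inj_on (tail G) (in_arcs G v)"
    by (rule inj_onI) (auto intro!: no_multi_arcs simp: in_arcs_def arc_to_ends_def)
  moreover have "tail G ` in_arcs G v = in_neighbours G v"
    by (force simp: in_neighbours_def in_arcs_def arcs_ends_def arc_to_ends_def)
  ultimately show ?thesis
    unfolding in_degree_def by (metis card_image)
qed

text \<open>Both in-neighbourhoods have \<open>k\<close> elements and share at most \<open>d\<close> of them.\<close>

lemma card_in_neighbours_sym_diff:
  assumes D: "ordinary_graph D n k a b c" and d: "d = Max {a, b, c}"
    and uv: "u \<in> verts D" "v \<in> verts D" "u \<noteq> v"
  shows "2 * (real k - real d)
    \<le> card (sym_diff (in_neighbours D u) (in_neighbours D v))"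
proof -
  interpret digraph D using D by (simp add: ordinary_graph_def)
  let ?A = "in_neighbours D u" and ?B = "in_neighbours D v"
  have fin: "finite ?A" "finite ?B" by (auto simp: in_neighbours_def)
  have k: "card ?A = k" "card ?B = k"
    using D uv by (auto simp: card_in_neighbours ordinary_graph_def regular_def)
  have "?A \<inter> ?B = common_in_neighbours D u v"
    by (auto simp: in_neighbours_def common_in_neighbours_def)
  moreover have "card (common_in_neighbours D u v) \<in> {a, b, c}"
    using D uv by (auto simp: ordinary_graph_def Let_def)
  ultimately have "card (?A \<inter> ?B) \<le> d"
    unfolding d by (metis Max_ge finite.emptyI finite.insertI)
  moreover have "card (sym_diff ?A ?B) = card (?A - ?B) + card (?B - ?A)"
    by (rule card_Un_disjoint) (use fin in auto)
  moreover have "card (?A - ?B) + card (?A \<inter> ?B) = k" "card (?B - ?A) + card (?A \<inter> ?B) = k"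
    using card_Diff_subset_Int[of ?A ?B] card_Diff_subset_Int[of ?B ?A] k fin
      card_mono[of ?A "?A \<inter> ?B"] card_mono[of ?B "?A \<inter> ?B"]
    by (auto simp: Int_commute)
  ultimately have "2 * k \<le> card (sym_diff ?A ?B) + 2 * d"
    by presburger
  then have "real (2 * k) \<le> real (card (sym_diff ?A ?B) + 2 * d)"
    by (rule of_nat_mono)
  then show ?thesis by simp
qed

section \<open>Localization number and metric dimension\<close>

text \<open>Cops that stay on a least resolving set need no history: the distance vector of round \<open>1\<close>
  alone fixes the vertex reached in that round.\<close>

lemma (in fin_digraph) localization_number_le_metric_dimension:
  "localization_number G \<le> metric_dimension G"
proof -
  have "resolving_set G (verts G)" by (auto simp: resolving_set_def)
  then have "\<exists>R. resolving_set G R \<and> card R = metric_dimension G"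
    unfolding metric_dimension_def
    by (intro LeastI[of "\<lambda>m. \<exists>R. resolving_set G R \<and> card R = m" "card (verts G)"]) blast
  then obtain R where R: "resolving_set G R" "card R = metric_dimension G" by blast
  have sub: "R \<subseteq> verts G" using R(1) by (simp add: resolving_set_def)
  then have "finite R" using finite_verts finite_subset by blast
  then obtain us where us: "set us = R" "distinct us" using finite_distinct_list by blast
  let ?\<sigma> = "\<lambda>_ :: ereal list list. us"
  have round_1: "x 1 \<in> verts G" if "robber_play G x" for x
  proof -
    have "x 0 \<in> verts G" and "x (Suc 0) = x 0 \<or> x 0 \<rightarrow>\<^bsub>G\<^esub> x (Suc 0)"
      using that by (simp_all add: robber_play_def)
    then show ?thesis by (auto dest: adj_in_verts)
  qed
  have "located_in_round G ?\<sigma> x 1" if x: "robber_play G x" for x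
  proof -
    have "y 1 = x 1" if y: "robber_play G y"
      and eq: "distance_vectors G ?\<sigma> y 1 = distance_vectors G ?\<sigma> x 1" for y
    proof (rule resolving_set_determines[OF R(1)])
      show "distance G w (y 1) = distance G w (x 1)" if "w \<in> R" for w
        using eq that us(1) by auto
    qed (use x y round_1 in auto)
    then show ?thesis
      unfolding located_in_round_def possible_positions_def using x by blast
  qed
  moreover have "length us = metric_dimension G"
    using us R(2) distinct_card by metis
  ultimately have "locating_strategy G (metric_dimension G) ?\<sigma>"
    unfolding locating_strategy_def using us(1) sub by auto
  then show ?thesis
    unfolding localization_number_def by (intro Least_le) blast
qed

section \<open>The bound for ordinary graphs\<close>

theorem theorem2p8:
  fixes D :: "('a, 'b) pre_digraph" and n k a b c d :: nat
  assumes "ordinary_graph D n k a b c"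
    and "d = Max {a, b, c}"
    and "real k - real d > ln (real n)"
  shows "localization_number D \<le> metric_dimension D \<and>
         int (metric_dimension D) \<le> \<lceil>real n * ln (real n) / (real k - real d)\<rceil>"
proof
  interpret digraph D using assms(1) by (simp add: ordinary_graph_def)
  show "localization_number D \<le> metric_dimension D"
    by (rule localization_number_le_metric_dimension)
  have n: "card (verts D) = n" using assms(1) by (simp add: ordinary_graph_def)
  \<comment> \<open>The digraph may have no vertices; then \<open>ln 0 = 0\<close>.\<close>
  have ln_n: "0 \<le> ln (real n)"
    by (cases "n = 0") auto
  then have kd: "0 < real k - real d" using assms(3) by linarith
  define r where "r = nat \<lceil>real n * ln (real n) / (real k - real d)\<rceil>"
  have nonneg: "0 \<le> real n * ln (real n) / (real k - real d)"
    using ln_n kd by simp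
  then have r: "real n * ln (real n) / (real k - real d) \<le> r"
    unfolding r_def by linarith
  let ?I = "{(u, v). u \<in> verts D \<and> v \<in> verts D \<and> u \<noteq> v}"
  let ?S = "\<lambda>(u, v). sym_diff (in_neighbours D u) (in_neighbours D v)"
  let ?s = "2 * (real k - real d)"
  have I: "finite ?I" "card ?I * (1 - ?s / card (verts D)) ^ r < 1"
  proof -
    have sub: "?I \<subseteq> verts D \<times> verts D" by auto
    then show fin: "finite ?I" by (rule finite_subset) simp
    show "card ?I * (1 - ?s / card (verts D)) ^ r < 1"
    proof (cases "?I = {}")
      case True
      then show ?thesis by (simp only: True) simp
    next
      case False
      then obtain u v where uv: "u \<in> verts D" "v \<in> verts D" "u \<noteq> v" by auto
      then have n0: "real n > 0" using n by (auto simp: card_gt_0_iff)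
      \<comment> \<open>The bound below is \<open>1 / n\<^sup>2\<close> per pair, so the pairs must number strictly fewer than \<open>n\<^sup>2\<close>;
        the diagonal provides the gap.\<close>
      have "(u, u) \<in> verts D \<times> verts D" "(u, u) \<notin> ?I" using uv by auto
      then have "?I \<subset> verts D \<times> verts D" using sub by blast
      then have "card ?I < card (verts D \<times> verts D)"
        by (rule psubset_card_mono[rotated]) simp
      also have "\<dots> = n ^ 2"
        by (simp add: card_cartesian_product n power2_eq_square)
      finally have "real (card ?I) < real (n ^ 2)"
        by (simp only: of_nat_less_iff)
      then have cI: "real (card ?I) < real n ^ 2"
        by (simp only: of_nat_power)
      have "?s \<le> card (?S (u, v))"
        using card_in_neighbours_sym_diff[OF assms(1,2) uv] by simp
      also have "card (?S (u, v)) \<le> n"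
        unfolding n[symmetric] by (rule card_mono) (auto simp: in_neighbours_def)
      finally have "?s / n \<le> 1" using n0 by simp
      then have "(1 - ?s / n) ^ r \<le> exp (- (?s / n)) ^ r"
        using exp_ge_add_one_self[of "- (?s / n)"] by (intro power_mono) auto
      also have "\<dots> = exp (- (r * (?s / n)))"
        by (simp add: exp_of_nat_mult[symmetric])
      also have "\<dots> \<le> exp (- (2 * ln n))"
        using r kd n0 by (simp add: field_simps)
      also have "\<dots> = 1 / real n ^ 2"
        using n0 by (simp add: exp_minus exp_double inverse_eq_divide)
      finally have "card ?I * (1 - ?s / n) ^ r \<le> card ?I * (1 / real n ^ 2)"
        by (intro mult_left_mono) auto
      also have "\<dots> < 1" using cI n0 by simp
      finally show ?thesis by (simp add: n)
    qed
  qed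
  have "\<exists>R \<subseteq> verts D. card R \<le> r \<and> (\<forall>i \<in> ?I. ?S i \<inter> R \<noteq> {})"
  proof (rule greedy_hitting_set[OF finite_verts I(1) _ _ I(2)])
    show "?S i \<subseteq> verts D" if "i \<in> ?I" for i
      by (auto simp: in_neighbours_def split: prod.splits)
    show "?s \<le> card (?S i)" if "i \<in> ?I" for i
      using that card_in_neighbours_sym_diff[OF assms(1,2)] by auto
  qed
  then obtain R where R: "R \<subseteq> verts D" "card R \<le> r" "\<forall>i \<in> ?I. ?S i \<inter> R \<noteq> {}"
    by blast
  have "resolving_set D R"
    using R(3) by (intro resolving_setI_in_neighbours[OF R(1)]) auto
  then have "metric_dimension D \<le> card R"
    unfolding metric_dimension_def by (intro Least_le) blast
  then have "metric_dimension D \<le> r" using R(2) by linarith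
  moreover have "0 \<le> \<lceil>real n * ln (real n) / (real k - real d)\<rceil>"
    using nonneg by linarith
  ultimately show "int (metric_dimension D) \<le> \<lceil>real n * ln (real n) / (real k - real d)\<rceil>"
    unfolding r_def by linarith
qed

end
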